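(* Let $T$ be a tree of order at least two. Then the following statements are equivalent: (1) $T$ is not a corona graph. (2) There exists a set $D \in \mathcal{A}_{\gamma}(T)$ such that $\kappa(T-D) > |D|$. (3) $\gamma_{\rm a}(T) = \gamma(T)$. (4) There exists a set $D \in \mathcal{A}_{\gamma}(T)$ such that $D \cap D' \neq \emptyset$ for every $D' \in \mathcal{A}_{\gamma}(T)$.
   Context: Graphs are finite, simple, undirected, with nonempty vertex set; $V_G$ is the vertex set of $G$. A dominating set of $G$ is a set $D \subseteq V_G$ such that every vertex of $V_G \setminus D$ is adjacent to at least one vertex of $D$. The domination number $\gamma(G)$ is the minimum cardinality of a dominating set, and $\mathcal{A}_{\gamma}(G)$ is the set of all dominating sets of $G$ of cardinality $\gamma(G)$. An accurate dominating set of $G$ is a dominating set $D$ of $G$ such that no $|D|$-element subset of $V_G \setminus D$ is a dominating set of $G$; the accurate domination number $\gamma_{\rm a}(G)$ is the minimum cardinality of an accurate dominating set of $G$. For a graph $F$, the corona $F \circ K_1$ is the graph obtained from $F$ by adding, for each vertex $v$ of $F$, a new vertex $v'$ and the edge $vv'$. A graph $G$ is a corona graph if $G = F \circ K_1$ (up to isomorphism) for some connected graph $F$. $G - S$ denotes the graph obtained from $G$ by deleting the vertices of $S$, and $\kappa(G)$ denotes the number of connected components of $G$ (so $\kappa$ is not the connectivity). *)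

theory Defs
  imports "Graph_Theory.Digraph_Isomorphism"
begin

text \<open>
  A finite simple undirected graph is a \<^locale>\<open>pair_graph\<close>: a finite vertex set together with
  a symmetric irreflexive arc relation, each edge being represented by its two opposite arcs.
\<close>

text \<open>
  In a symmetric digraph every edge yields a closed walk of length two which the library counts as
  a cycle, so the library's notions of forest and tree are unsuitable here. The cycles of the
  undirected graph are the library cycles of length at least three. Connectedness includes
  nonemptiness of the vertex set.
\<close>

definition undirected_tree :: "'a pair_pre_digraph \<Rightarrow> bool" where
  "undirected_tree G \<longleftrightarrow> pair_graph G \<and> connected (with_proj G) \<and>
     \<not> (\<exists>p. pre_digraph.cycle (with_proj G) p \<and> 3 \<le> length p)"

definition dominating_set :: "'a pair_pre_digraph \<Rightarrow> 'a set \<Rightarrow> bool" where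
  "dominating_set G D \<longleftrightarrow> D \<subseteq> pverts G \<and> (\<forall>v \<in> pverts G - D. \<exists>u \<in> D. (v, u) \<in> parcs G)"

definition domination_number :: "'a pair_pre_digraph \<Rightarrow> nat" where
  "domination_number G = (LEAST k. \<exists>D. dominating_set G D \<and> card D = k)"

definition min_dominating_sets :: "'a pair_pre_digraph \<Rightarrow> 'a set set" where
  "min_dominating_sets G = {D. dominating_set G D \<and> card D = domination_number G}"

definition accurate_dominating_set :: "'a pair_pre_digraph \<Rightarrow> 'a set \<Rightarrow> bool" where
  "accurate_dominating_set G D \<longleftrightarrow> dominating_set G D \<and>
     \<not> (\<exists>D'. D' \<subseteq> pverts G - D \<and> card D' = card D \<and> dominating_set G D')"

definition accurate_domination_number :: "'a pair_pre_digraph \<Rightarrow> nat" where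
  "accurate_domination_number G = (LEAST k. \<exists>D. accurate_dominating_set G D \<and> card D = k)"

text \<open>The copy \<open>Inr v\<close> is the new leaf attached to the vertex \<open>Inl v\<close>.\<close>

definition corona_K1 :: "'a pair_pre_digraph \<Rightarrow> ('a + 'a) pair_pre_digraph" where
  "corona_K1 F = \<lparr> pverts = Inl ` pverts F \<union> Inr ` pverts F,
     parcs = {(Inl u, Inl v) | u v. (u, v) \<in> parcs F}
       \<union> {(Inl v, Inr v) | v. v \<in> pverts F} \<union> {(Inr v, Inl v) | v. v \<in> pverts F} \<rparr>"

text \<open>
  Taking \<open>F\<close> over the same vertex type as \<open>G\<close> is no restriction: \<open>F\<close> embeds into its corona, hence
  is isomorphic to a graph on a subset of the vertices of \<open>G\<close>.
\<close>

definition corona_graph :: "'a pair_pre_digraph \<Rightarrow> bool" where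
  "corona_graph G \<longleftrightarrow> (\<exists>F :: 'a pair_pre_digraph. pair_graph F \<and> connected (with_proj F) \<and>
     digraph_iso (with_proj (corona_K1 F)) (with_proj G))"

definition delete_verts :: "('a, 'b) pre_digraph \<Rightarrow> 'a set \<Rightarrow> ('a, 'b) pre_digraph" where
  "delete_verts G S = G \<restriction> (verts G - S)"

text \<open>
  For symmetric digraphs, the strongly connected components are the connected components of the
  undirected graph.
\<close>

definition num_components :: "('a, 'b) pre_digraph \<Rightarrow> nat" where
  "num_components G = card (pre_digraph.sccs G)"

end

theory Submission
  imports Defs
begin

text \<open>
  Let \<open>D\<close> be a minimum dominating set without leaves that spans as few edges as possible, and
  suppose that \<open>d \<in> D\<close> has exactly one neighbour \<open>q\<close> outside \<open>D\<close>. Then \<open>d\<close> also has a neighbour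
  in \<open>D\<close>, so by minimality \<open>q\<close> is a private neighbour of \<open>d\<close>. If \<open>q\<close> were not a leaf, exchanging
  \<open>d\<close> for \<open>q\<close> would give such a set spanning fewer edges. Hence \<open>q\<close> is a leaf. Unless \<open>D\<close> consists
  of the supports of a corona, there is a root \<open>r \<notin> D\<close> which is not the only outside neighbour of
  any \<open>d \<in> D\<close>. Then every \<open>d \<in> D\<close> has a neighbour outside \<open>D\<close> that is separated from \<open>r\<close> by \<open>d\<close>.
  The components of these neighbours in \<open>T - D\<close> are pairwise distinct and differ from that of \<open>r\<close>,
  so \<open>T - D\<close> has more than \<open>|D|\<close> components.

  A dominating set disjoint from \<open>D\<close> meets every component of \<open>T - D\<close>, hence (2) implies (4). In a
  corona every dominating set meets all the pairs formed by a vertex and its leaf, so the complement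
  of a minimum dominating set is again one, and (4) fails.
\<close>

section \<open>Walks avoiding deleted vertices, and the components they define\<close>

lemma delete_verts_simps [simp]:
  "verts (delete_verts (with_proj G) S) = pverts G - S"
  "arcs_ends (delete_verts (with_proj G) S) = Restr (parcs G) (pverts G - S)"
  by (auto simp: delete_verts_def arcs_ends_conv)

context pair_graph
begin

text \<open>Connectedness by a walk in the graph with the vertices of \<open>S\<close> deleted.\<close>

abbreviation away :: "'a set \<Rightarrow> 'a rel" where
  "away S \<equiv> rtrancl_on (pverts G - S) (parcs G)"

lemma away_sym: "(u, v) \<in> away S \<Longrightarrow> (v, u) \<in> away S"
  using rtrancl_on_sym[of "parcs G"] arcs_symmetric by (metis symI symE)

lemma away_mono: "(u, v) \<in> away S \<Longrightarrow> S' \<subseteq> S \<Longrightarrow> (u, v) \<in> away S'"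
  by (rule rtrancl_on_mono[of "parcs G" _ "pverts G - S"]) auto

lemma away_arc: "(u, v) \<in> parcs G \<Longrightarrow> u \<notin> S \<Longrightarrow> v \<notin> S \<Longrightarrow> (u, v) \<in> away S"
  by (meson DiffI in_arcsD1 in_arcsD2 rtrancl_on_into_rtrancl_on rtrancl_on_refl)

lemma away_class_eq: "(u, w) \<in> away S \<Longrightarrow> away S `` {u} = away S `` {w}"
  by (auto dest: rtrancl_on_trans[of u w] rtrancl_on_trans[OF away_sym])

text \<open>\<open>rtrancl_on\<close> already confines walks to the remaining vertices, so
  restricting the arcs as well changes nothing.\<close>

lemma reachable_delete_verts:
  "reachable (delete_verts (with_proj G) S) u v \<longleftrightarrow> (u, v) \<in> away S"
proof
  assume "(u, v) \<in> away S"
  then have "(u, v) \<in> rtrancl_on (pverts G - S) (Restr (parcs G) (pverts G - S))"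
    by induct (auto intro: converse_rtrancl_on_into_rtrancl_on)
  then show "reachable (delete_verts (with_proj G) S) u v"
    by (simp add: reachable_def)
qed (auto simp: reachable_def intro: rtrancl_on_mono[rotated 2])

text \<open>A component is induced by its vertex set, so components can be counted by their vertex
  sets, which are the classes of \<open>away S\<close>.\<close>

lemma num_components_delete_verts:
  "num_components (delete_verts (with_proj G) S) = card ((\<lambda>u. away S `` {u}) ` (pverts G - S))"
proof -
  let ?H = "delete_verts (with_proj G) S"
  interpret H: wf_digraph ?H
    unfolding delete_verts_def by (rule wellformed_induce_subgraph)
  have "inj_on verts H.sccs"
    by (rule inj_onI) (metis H.in_sccs_imp_induced H.induce_eq_iff_induced)
  then have "card H.sccs = card H.sccs_verts"
    by (simp add: H.sccs_verts_conv card_image)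
  moreover have "H.scc_of u = away S `` {u}" for u
    by (auto simp: H.scc_of_def reachable_delete_verts away_sym)
  ultimately show ?thesis
    by (simp add: num_components_def H.sccs_verts_conv_scc_of)
qed

text \<open>A path from \<open>x\<close> to \<open>y\<close> avoiding \<open>d\<close> closes up
  through \<open>d\<close>. In a tree, distinct neighbours of \<open>d\<close> are therefore
  separated by \<open>d\<close>.\<close>

lemma cycle_through:
  assumes "(d, x) \<in> parcs G" "(d, y) \<in> parcs G" "x \<noteq> y" "(x, y) \<in> away {d}"
  shows "\<exists>p. cycle p \<and> 3 \<le> length p"
proof -
  let ?H = "delete_verts (with_proj G) {d}"
  interpret H: wf_digraph ?H
    unfolding delete_verts_def by (rule wellformed_induce_subgraph)
  obtain p where p: "H.apath x p y"
    using assms(4) by (auto simp: reachable_delete_verts[symmetric] H.reachable_apath)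
  have vs: "H.awalk_verts = pawalk_verts"
    unfolding delete_verts_def by (rule awalk_verts_induce)
  have "H.awalk x p y" using p by (simp add: H.apath_def)
  moreover have "subgraph ?H (with_proj G)"
    unfolding delete_verts_def by (rule subgraph_induce_subgraphI) auto
  ultimately have walk: "awalk x p y" by (blast intro: subgraph_awalk_imp_awalk)
  have "set (pawalk_verts x p) \<subseteq> pverts G - {d}"
    using H.awalk_verts_in_verts \<open>H.awalk x p y\<close> H.awalkE
    by (metis delete_verts_simps(1) vs)
  have dist: "distinct (pawalk_verts x p)" using p by (simp add: H.apath_def vs)
  have "p \<noteq> []" using walk assms(3) by (auto simp: awalk_Nil_iff)
  let ?c = "(d, x) # p @ [(y, d)]"
  have "awalk d ?c d"
    using walk assms in_arcsD1 arcs_symmetric by (auto simp: awalk_simps)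
  moreover have "pawalk_verts x (p @ [(y, d)]) = pawalk_verts x p @ [d]"
    using walk by (induct p arbitrary: x) (auto simp: awalk_simps)
  then have "distinct (tl (pawalk_verts d ?c))"
    using dist \<open>set (pawalk_verts x p) \<subseteq> _\<close> by auto
  ultimately have "cycle ?c" unfolding cycle_def by blast
  \<comment> \<open>The path has at least one arc because \<open>x \<noteq> y\<close>; the two arcs
    at \<open>d\<close> make three.\<close>
  moreover have "3 \<le> length ?c" using \<open>p \<noteq> []\<close> by (cases p) auto
  ultimately show ?thesis by blast
qed

section \<open>Minimum dominating sets: private neighbours and exchanges\<close>

lemma finite_dominating_set: "dominating_set G D \<Longrightarrow> finite D"
  unfolding dominating_set_def using pair_finite_verts finite_subset by blast

lemma domination_number_le: "dominating_set G D \<Longrightarrow> domination_number G \<le> card D"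
  unfolding domination_number_def by (rule Least_le) blast

lemma min_dominating_sets_nonempty: "min_dominating_sets G \<noteq> {}"
proof -
  have "dominating_set G (pverts G)" by (simp add: dominating_set_def)
  then have "\<exists>k D. dominating_set G D \<and> card D = k" by blast
  from LeastI_ex[OF this] show ?thesis
    unfolding min_dominating_sets_def domination_number_def by blast
qed

lemma min_dominating_setD:
  assumes "D \<in> min_dominating_sets G"
  shows "D \<subseteq> pverts G" "finite D" "card D = domination_number G"
    "v \<in> pverts G - D \<Longrightarrow> \<exists>u\<in>D. (v, u) \<in> parcs G"
  using assms finite_dominating_set[of D]
  by (auto simp: min_dominating_sets_def dominating_set_def)

lemma not_dominating_remove:
  assumes "D \<in> min_dominating_sets G" "d \<in> D"
  shows "\<not> dominating_set G (D - {d})"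
proof
  assume "dominating_set G (D - {d})"
  then have "card D \<le> card (D - {d})"
    using domination_number_le min_dominating_setD(3)[OF assms(1)] by metis
  then show False
    using min_dominating_setD(2)[OF assms(1)] assms(2) by (meson card_Diff1_less not_le)
qed

text \<open>Otherwise \<open>d\<close> could be dropped: \<open>w\<close> would dominate it, and no
  vertex outside \<open>D\<close> would be adjacent to it. The arc to \<open>w\<close> says that
  \<open>d\<close> is not isolated.\<close>

lemma external_neighbour:
  assumes "D \<in> min_dominating_sets G" "d \<in> D" "(d, w) \<in> parcs G"
  obtains q where "(d, q) \<in> parcs G" "q \<notin> D"
proof (rule ccontr)
  assume "\<not> thesis"
  with that have "parcs G `` {d} \<subseteq> D" by blast
  then have "dominating_set G (D - {d})"
    unfolding dominating_set_def
  proof (intro conjI ballI)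
    fix v assume v: "v \<in> pverts G - (D - {d})"
    show "\<exists>u\<in>D - {d}. (v, u) \<in> parcs G"
    proof (cases "v = d")
      case True
      then show ?thesis using \<open>parcs G `` {d} \<subseteq> D\<close> assms(3) no_loops' by blast
    next
      case False
      then have "v \<notin> D" using v by blast
      then obtain u where "u \<in> D" "(v, u) \<in> parcs G"
        using v min_dominating_setD(4)[OF assms(1)] by blast
      then show ?thesis
        using \<open>parcs G `` {d} \<subseteq> D\<close> \<open>v \<notin> D\<close> arcs_symmetric by blast
    qed
  qed (use min_dominating_setD(1)[OF assms(1)] in blast)
  then show False using not_dominating_remove assms by blast
qed

text \<open>With a second dominator \<open>e\<close> of \<open>q\<close>, the vertex
  \<open>d\<close> could be dropped: \<open>w\<close> dominates \<open>d\<close>, \<open>e\<close>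
  dominates \<open>q\<close>, and no other vertex outside \<open>D\<close> is adjacent to
  \<open>d\<close>.\<close>

lemma unique_external_neighbour_private:
  assumes "D \<in> min_dominating_sets G" "d \<in> D" "(d, w) \<in> parcs G" "w \<in> D"
    and "parcs G `` {d} - D = {q}" "(q, e) \<in> parcs G" "e \<in> D"
  shows "e = d"
proof (rule ccontr)
  assume "e \<noteq> d"
  have "\<exists>u\<in>D - {d}. (v, u) \<in> parcs G" if v: "v \<in> pverts G - (D - {d})" for v
  proof (cases "v = d \<or> v = q")
    case True
    then show ?thesis using assms \<open>e \<noteq> d\<close> no_loops' by blast
  next
    case False
    then obtain u where "u \<in> D" "(v, u) \<in> parcs G"
      using v min_dominating_setD(4)[OF assms(1)] by blast
    then show ?thesis using False v assms(5) arcs_symmetric by blast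
  qed
  then have "dominating_set G (D - {d})"
    using min_dominating_setD(1)[OF assms(1)] unfolding dominating_set_def by blast
  then show False using not_dominating_remove assms by blast
qed

text \<open>Only \<open>q\<close> and \<open>d\<close> can lose their domination when
  \<open>d\<close> leaves \<open>D\<close>; adding \<open>q\<close> covers both.\<close>

lemma swap_min_dominating:
  assumes "D \<in> min_dominating_sets G" "d \<in> D" "parcs G `` {d} - D = {q}"
  shows "insert q (D - {d}) \<in> min_dominating_sets G"
proof -
  let ?D = "insert q (D - {d})"
  note D = min_dominating_setD[OF assms(1)]
  have q: "q \<notin> D" "(d, q) \<in> parcs G" using assms(3) by auto
  have "\<exists>u\<in>?D. (v, u) \<in> parcs G" if v: "v \<in> pverts G - ?D" for v
  proof (cases "v = d")
    case False
    then obtain u where "u \<in> D" "(v, u) \<in> parcs G" using v D(4) by blast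
    then show ?thesis using False v assms(3) arcs_symmetric by blast
  qed (use q in blast)
  then have "dominating_set G ?D"
    using D(1) q in_arcsD2 unfolding dominating_set_def by blast
  moreover have "card ?D = card D"
    using q(1) D(2) assms(2) by (metis Diff_iff card.insert card_Suc_Diff1 finite_Diff)
  ultimately show ?thesis using D(3) by (simp add: min_dominating_sets_def)
qed

text \<open>Ore's observation: without isolated vertices, \<open>external_neighbour\<close> makes
  the complement dominating. The cardinality bound then makes it minimum.\<close>

lemma complement_min_dominating:
  assumes "D \<in> min_dominating_sets G" and "\<And>v. v \<in> pverts G \<Longrightarrow> \<exists>w. (v, w) \<in> parcs G"
    and "card (pverts G - D) \<le> card D"
  shows "pverts G - D \<in> min_dominating_sets G"
proof -
  note D = min_dominating_setD[OF assms(1)]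
  have "dominating_set G (pverts G - D)"
    unfolding dominating_set_def
    using external_neighbour[OF assms(1)] assms(2) in_arcsD2 by (metis Diff_iff Diff_subset)
  then show ?thesis
    using domination_number_le[of "pverts G - D"] D(3) assms(3) by (simp add: min_dominating_sets_def)
qed

section \<open>Dominating sets disjoint from a given set, and accuracy\<close>

text \<open>Each vertex of \<open>G - D\<close> lies in \<open>D'\<close> or has a neighbour there,
  within its own component; so every component contains an element of \<open>D'\<close>.\<close>

lemma num_components_le_card_dominating:
  assumes "dominating_set G D'" "D' \<subseteq> pverts G - D"
  shows "num_components (delete_verts (with_proj G) D) \<le> card D'"
proof -
  have "(\<lambda>u. away D `` {u}) ` (pverts G - D) \<subseteq> (\<lambda>u. away D `` {u}) ` D'"
  proof safe
    fix u assume u: "u \<in> pverts G" "u \<notin> D"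
    obtain w where w: "w \<in> D'" "(u, w) \<in> away D"
    proof (cases "u \<in> D'")
      case True
      then show ?thesis using that u by simp
    next
      case False
      then obtain w where "w \<in> D'" "(u, w) \<in> parcs G"
        using assms(1) u unfolding dominating_set_def by blast
      then show ?thesis using that u away_arc assms(2) by blast
    qed
    then have "away D `` {u} = away D `` {w}" by (intro away_class_eq)
    then show "away D `` {u} \<in> (\<lambda>u. away D `` {u}) ` D'" using w by blast
  qed
  then show ?thesis
    unfolding num_components_delete_verts
    using finite_dominating_set[OF assms(1)] by (meson card_image_le card_mono finite_imageI le_trans)
qed

text \<open>For a minimum dominating set \<open>D\<close>, a set violating accuracy is the same
  thing as a minimum dominating set disjoint from \<open>D\<close>.\<close>

lemma accurate_domination_number_eq_iff:
  assumes "pverts G \<noteq> {}"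
  shows "accurate_domination_number G = domination_number G \<longleftrightarrow>
    (\<exists>D \<in> min_dominating_sets G. \<forall>D' \<in> min_dominating_sets G. D \<inter> D' \<noteq> {})"
proof -
  have acc: "accurate_dominating_set G D \<longleftrightarrow> (\<forall>D' \<in> min_dominating_sets G. D \<inter> D' \<noteq> {})"
    if "D \<in> min_dominating_sets G" for D
  proof -
    have D: "dominating_set G D" "card D = domination_number G"
      using that by (auto simp: min_dominating_sets_def)
    have "accurate_dominating_set G D \<longleftrightarrow>
        \<not> (\<exists>D' \<in> min_dominating_sets G. D' \<subseteq> pverts G - D)"
      using D by (auto simp: accurate_dominating_set_def min_dominating_sets_def)
    also have "D' \<subseteq> pverts G - D \<longleftrightarrow> D \<inter> D' = {}" if "D' \<in> min_dominating_sets G" for D'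
      using min_dominating_setD(1)[OF that] by blast
    then have "(\<exists>D' \<in> min_dominating_sets G. D' \<subseteq> pverts G - D) \<longleftrightarrow>
        (\<exists>D' \<in> min_dominating_sets G. D \<inter> D' = {})" by blast
    finally show ?thesis by blast
  qed
  \<comment> \<open>The whole vertex set is accurate, having an empty complement, so the
    \<open>LEAST\<close> in the accurate domination number is attained.\<close>
  have "card (pverts G) \<noteq> card ({} :: 'a set)" using assms pair_finite_verts by simp
  then have "accurate_dominating_set G (pverts G)"
    unfolding accurate_dominating_set_def dominating_set_def by (metis Diff_cancel empty_iff subset_empty subset_refl)
  then have ex: "\<exists>k D. accurate_dominating_set G D \<and> card D = k" by auto
  have "accurate_domination_number G = domination_number G \<longleftrightarrow>
      (\<exists>D \<in> min_dominating_sets G. accurate_dominating_set G D)"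
  proof
    assume "accurate_domination_number G = domination_number G"
    then show "\<exists>D \<in> min_dominating_sets G. accurate_dominating_set G D"
      using LeastI_ex[OF ex]
      by (auto simp: accurate_domination_number_def min_dominating_sets_def accurate_dominating_set_def)
  next
    assume "\<exists>D \<in> min_dominating_sets G. accurate_dominating_set G D"
    then obtain D where D: "D \<in> min_dominating_sets G" "accurate_dominating_set G D" by blast
    have "accurate_domination_number G \<le> domination_number G"
      unfolding accurate_domination_number_def using D
      by (intro Least_le) (auto simp: min_dominating_sets_def)
    moreover obtain D' where "accurate_dominating_set G D'"
      "card D' = accurate_domination_number G"
      using LeastI_ex[OF ex] unfolding accurate_domination_number_def by blast
    then have "domination_number G \<le> accurate_domination_number G"
      using domination_number_le[of D'] by (simp add: accurate_dominating_set_def)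
    ultimately show "accurate_domination_number G = domination_number G" by simp
  qed
  then show ?thesis using acc by blast
qed

section \<open>Dominating sets of a corona\<close>

text \<open>A leaf is adjacent only to its base, so \<open>D\<close> meets each pair of base and
  leaf. Hence the partner of every vertex outside \<open>D\<close> lies in \<open>D\<close>.\<close>

lemma corona_card_complement_le:
  assumes "corona_graph G" "dominating_set G D"
  shows "card (pverts G - D) \<le> card D"
proof -
  obtain F :: "'a pair_pre_digraph" and f
    where F: "pair_graph F"
      and iso: "pre_digraph.digraph_isomorphism (with_proj (corona_K1 F)) f"
      and G: "with_proj G = app_iso f (with_proj (corona_K1 F))"
    using assms(1) unfolding corona_graph_def digraph_iso_def by blast
  interpret F: pair_graph F by (rule F)
  let ?h = "iso_verts f"
  let ?V = "pverts (corona_K1 F)" and ?E = "parcs (corona_K1 F)"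
  have V: "pverts G = ?h ` ?V" using arg_cong[OF G, of verts] by simp
  have inj: "inj_on ?h ?V" using iso by (simp add: pre_digraph.digraph_isomorphism_def)
  \<comment> \<open>The isomorphism has a separate arc map, but it respects tails and heads; so the
    arcs of \<open>G\<close> are described by the vertex map \<open>?h\<close> alone.\<close>
  have "parcs G = arcs_ends (app_iso f (with_proj (corona_K1 F)))"
    using arg_cong[OF G, of arcs_ends] by simp
  also have "\<dots> = (\<lambda>e. (iso_tail f (iso_arcs f e), iso_head f (iso_arcs f e))) ` ?E"
    by (simp add: arcs_ends_conv image_image)
  also have "\<dots> = (\<lambda>e. (?h (fst e), ?h (snd e))) ` ?E"
    using iso by (intro image_cong) (simp_all add: pre_digraph.digraph_isomorphism_def)
  finally have E: "parcs G = (\<lambda>e. (?h (fst e), ?h (snd e))) ` ?E" .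
  have hit: "?h (Inl v) \<in> D \<or> ?h (Inr v) \<in> D" if v: "v \<in> pverts F" for v
  proof (rule ccontr)
    assume neg: "\<not> ?thesis"
    have "?h (Inr v) \<in> pverts G" using v by (auto simp: V corona_K1_def)
    then obtain u where u: "u \<in> D" "(?h (Inr v), u) \<in> parcs G"
      using assms(2) neg by (auto simp: dominating_set_def)
    then obtain a b where ab: "(a, b) \<in> ?E" "?h a = ?h (Inr v)" "?h b = u"
      unfolding E by force
    have "a \<in> ?V" "Inr v \<in> ?V"
      using ab(1) v by (auto simp: corona_K1_def dest: F.in_arcsD1)
    then have "a = Inr v" using inj ab(2) by (auto dest: inj_onD)
    then have "b = Inl v" using ab(1) by (auto simp: corona_K1_def)
    then show False using ab u neg by simp
  qed
  \<comment> \<open>\<open>?s\<close> exchanges base and leaf in each pair, carried over to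
    \<open>G\<close> by \<open>?h\<close>.\<close>
  let ?s = "\<lambda>x. ?h (case_sum Inr Inl (the_inv_into ?V ?h x))"
  have "pverts G - D \<subseteq> ?s ` D"
  proof
    fix x assume x: "x \<in> pverts G - D"
    then obtain a where a: "a \<in> ?V" "x = ?h a" by (auto simp: V)
    define b where "b = case_sum Inr Inl a"
    obtain v where "v \<in> pverts F" "a = Inl v \<or> a = Inr v"
      using a(1) by (auto simp: corona_K1_def)
    then have b: "b \<in> ?V" "case_sum Inr Inl b = a" "?h b \<in> D"
      using a(2) x hit[of v] by (auto simp: b_def corona_K1_def)
    then have "?s (?h b) = x" using a(2) the_inv_into_f_f[OF inj b(1)] by simp
    then show "x \<in> ?s ` D" using b(3) by blast
  qed
  then show ?thesis
    using finite_dominating_set[OF assms(2)] by (meson card_image_le card_mono finite_imageI le_trans)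
qed

end

section \<open>Trees, and recognising a corona inside one\<close>

locale pair_tree = pair_graph +
  assumes connected: "connected (with_proj G)"
    and no_long_cycle: "\<not> (\<exists>p. cycle p \<and> 3 \<le> length p)"
begin

lemma connected_away: "u \<in> pverts G \<Longrightarrow> v \<in> pverts G \<Longrightarrow> (u, v) \<in> away {}"
  using symmetric_connected_imp_strongly_connected[OF pair_sym_arcs connected]
  by (simp add: strongly_connected_def reachable_def)

text \<open>The subgraph induced by \<open>D\<close> serves as the base graph, with
  \<open>\<pi> d\<close> as the leaf attached to \<open>d\<close>.\<close>

lemma corona_graphI:
  assumes "D \<subseteq> pverts G" "D \<noteq> {}" and bij: "bij_betw \<pi> D (pverts G - D)"
    and leaf: "\<And>d. d \<in> D \<Longrightarrow> parcs G `` {\<pi> d} = {d}"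
  shows "corona_graph G"
proof -
  define F where "F = \<lparr>pverts = D, parcs = Restr (parcs G) D\<rparr>"
  have F: "pair_graph F"
    using assms(1) pair_finite_verts pair_finite_arcs no_loops' arcs_symmetric
    by unfold_locales
      (auto simp: F_def symmetric_def arcs_ends_conv sym_def finite_subset)
  \<comment> \<open>\<open>\<rho>\<close> retracts each leaf to its neighbour in \<open>D\<close>.
    Arcs inside \<open>D\<close> are kept and leaf arcs collapse, so walks of \<open>G\<close>
    project to walks inside \<open>D\<close>; this gives connectedness of \<open>F\<close>.\<close>
  define \<rho> where "\<rho> v = (if v \<in> D then v else the_inv_into D \<pi> v)" for v
  have inj: "inj_on \<pi> D" and img: "\<pi> ` D = pverts G - D"
    using bij by (auto simp: bij_betw_def)
  have \<rho>: "\<rho> (\<pi> d) = d" if "d \<in> D" for d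
    using that inj img the_inv_into_f_f[OF inj that] by (auto simp: \<rho>_def)
  have arc: "(u, v) \<in> Restr (parcs G) D \<or> (u \<in> D \<and> v = \<pi> u) \<or> (v \<in> D \<and> u = \<pi> v)"
    if "(u, v) \<in> parcs G" for u v
  proof -
    have "u \<in> D \<or> u \<in> \<pi> ` D" "v \<in> D \<or> v \<in> \<pi> ` D"
      using img in_arcsD1[OF that] in_arcsD2[OF that] by auto
    moreover have "v = d" if "d \<in> D" "u = \<pi> d" for d
      using leaf[OF that(1)] that(2) \<open>(u, v) \<in> parcs G\<close> by auto
    moreover have "u = d" if "d \<in> D" "v = \<pi> d" for d
      using leaf[OF that(1)] that(2) arcs_symmetric[OF \<open>(u, v) \<in> parcs G\<close>] by auto
    ultimately show ?thesis using that by auto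
  qed
  have leaf': "(d, \<pi> d) \<in> parcs G" "(\<pi> d, d) \<in> parcs G" if "d \<in> D" for d
    using leaf[OF that] arcs_symmetric by blast+
  have "(\<rho> u, \<rho> v) \<in> rtrancl_on D (Restr (parcs G) D)" if "(u, v) \<in> away {}" for u v
    using that
  proof (induct rule: rtrancl_on_induct)
    case base
    then have "u \<in> D \<or> u \<in> \<pi> ` D" using img by auto
    then have "\<rho> u \<in> D"
    proof
      assume "u \<in> D"
      then show ?thesis by (simp add: \<rho>_def)
    qed (use \<rho> in auto)
    then show ?case by simp
  next
    case (step y z)
    from arc[OF step(2)] show ?case
    proof (elim disjE conjE)
      assume "(y, z) \<in> Restr (parcs G) D"
      then show ?thesis
        using step(5) by (auto simp: \<rho>_def intro: rtrancl_on_into_rtrancl_on)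
    qed (use step(5) \<rho> in \<open>auto simp: \<rho>_def split: if_splits\<close>)
  qed
  then have "(u, v) \<in> rtrancl_on D (Restr (parcs G) D)" if "u \<in> D" "v \<in> D" for u v
    using connected_away[of u v] that assms(1) by (force simp: \<rho>_def)
  then have "connected (with_proj F)"
    using assms(2) rtrancl_on_mono[of "Restr (parcs G) D" "(Restr (parcs G) D)\<^sup>s" D D]
    by (auto simp: connected_conv F_def symcl_def)
  define h where "h = case_sum id \<pi>"
  \<comment> \<open>Arcs remain pairs, so the new head and tail maps are the projections and the arc
    map is \<open>h\<close> on both coordinates.\<close>
  define f where "f = \<lparr>iso_verts = h, iso_arcs = map_prod h h, iso_head = snd, iso_tail = fst\<rparr>"
  have V: "pverts (corona_K1 F) = Inl ` D \<union> Inr ` D"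
    and E: "parcs (corona_K1 F) = {(Inl u, Inl v) | u v. (u, v) \<in> Restr (parcs G) D}
       \<union> {(Inl v, Inr v) | v. v \<in> D} \<union> {(Inr v, Inl v) | v. v \<in> D}"
    by (auto simp: corona_K1_def F_def)
  have wf: "e \<in> parcs (corona_K1 F) \<Longrightarrow> e \<in> pverts (corona_K1 F) \<times> pverts (corona_K1 F)" for e
    unfolding V E by blast
  have injh: "inj_on h (pverts (corona_K1 F))"
    unfolding V
  proof (rule inj_onI)
    fix x y assume "x \<in> Inl ` D \<union> Inr ` D" "y \<in> Inl ` D \<union> Inr ` D" "h x = h y"
    moreover have "\<pi> d \<notin> D" if "d \<in> D" for d using img that by blast
    ultimately show "x = y" by (auto simp: h_def dest: inj_onD[OF inj])
  qed
  have "inj_on (map_prod h h) (parcs (corona_K1 F))"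
    by (rule inj_on_subset[OF map_prod_inj_on[OF injh injh]]) (use wf in blast)
  moreover have "wf_digraph (with_proj (corona_K1 F))"
    by unfold_locales (use wf in force)+
  ultimately have "pre_digraph.digraph_isomorphism (with_proj (corona_K1 F)) f"
    using injh by (simp add: pre_digraph.digraph_isomorphism_def f_def)
  moreover have "with_proj G = app_iso f (with_proj (corona_K1 F))"
  proof (rule pre_digraph.equality)
    have "pverts G = h ` pverts (corona_K1 F)"
      using img assms(1) unfolding V by (auto simp: h_def image_Un image_image)
    then show "verts (with_proj G) = verts (app_iso f (with_proj (corona_K1 F)))"
      by (simp add: f_def)
    have "parcs G = map_prod h h ` parcs (corona_K1 F)"
    proof (intro equalityI subsetI)
      fix e assume "e \<in> parcs G"
      then obtain u v where e: "e = (u, v)" "(u, v) \<in> parcs G" by (cases e) auto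
      from arc[OF e(2)] obtain e' where "e' \<in> parcs (corona_K1 F)" "map_prod h h e' = (u, v)"
      proof (elim disjE conjE)
        assume "(u, v) \<in> Restr (parcs G) D"
        then show ?thesis by (intro that[of "(Inl u, Inl v)"]) (auto simp: E h_def)
      next
        assume "u \<in> D" "v = \<pi> u"
        then show ?thesis by (intro that[of "(Inl u, Inr u)"]) (auto simp: E h_def)
      next
        assume "v \<in> D" "u = \<pi> v"
        then show ?thesis by (intro that[of "(Inr v, Inl v)"]) (auto simp: E h_def)
      qed
      then show "e \<in> map_prod h h ` parcs (corona_K1 F)" using e(1) by (metis imageI)
    next
      fix e assume "e \<in> map_prod h h ` parcs (corona_K1 F)"
      then show "e \<in> parcs G" using leaf' by (auto simp: E h_def)
    qed
    then show "arcs (with_proj G) = arcs (app_iso f (with_proj (corona_K1 F)))"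
      by (simp add: f_def)
  qed (simp_all add: f_def)
  ultimately show ?thesis
    using F \<open>connected (with_proj F)\<close> unfolding corona_graph_def digraph_iso_def by blast
qed

abbreviation leaf :: "'a \<Rightarrow> bool" where
  "leaf v \<equiv> is_singleton (parcs G `` {v})"

lemma leaf_neighbour: "leaf v \<Longrightarrow> (v, w) \<in> parcs G \<Longrightarrow> parcs G `` {v} = {w}"
  by (metis Image_singleton_iff is_singleton_def singletonD)

lemma has_neighbour:
  assumes "2 \<le> card (pverts G)" "v \<in> pverts G"
  obtains w where "(v, w) \<in> parcs G"
proof -
  obtain u where "u \<in> pverts G" "u \<noteq> v"
    using assms by (metis card_le_Suc0_iff_eq not_less_eq_eq numeral_2_eq_2 pair_finite_verts)
  then show ?thesis
    using converse_rtrancl_on_cases[OF connected_away[OF assms(2)]] that by metis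
qed

text \<open>The set \<open>{l, s}\<close> is closed under adjacency, so by connectedness the tree is
  a single edge, the corona of one vertex.\<close>

lemma corona_if_adjacent_leaves:
  assumes "parcs G `` {l} = {s}" "parcs G `` {s} = {l}"
  shows "corona_graph G"
proof (rule corona_graphI[of "{s}" "\<lambda>_. l"])
  have ls: "l \<in> pverts G" "s \<in> pverts G" "l \<noteq> s"
    using assms in_arcsD1 in_arcsD2 no_loops' by blast+
  have "v \<in> {l, s}" if "(l, v) \<in> away {}" for v
    using that by (induct rule: rtrancl_on_induct) (use assms in auto)
  then have "pverts G = {l, s}" using ls connected_away by blast
  then show "{s} \<subseteq> pverts G" "bij_betw (\<lambda>_. l) {s} (pverts G - {s})"
    using ls by (auto simp: bij_betw_def)
qed (use assms in auto)

section \<open>Choice of the minimum dominating set\<close>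

text \<open>Take \<open>D\<close> with the fewest leaves. Exchanging a leaf in \<open>D\<close> for
  its neighbour would reduce their number, since that neighbour is a leaf only in a single
  edge.\<close>

lemma leafless_min_dominating_set:
  assumes "2 \<le> card (pverts G)" "\<not> corona_graph G"
  obtains D where "D \<in> min_dominating_sets G" "\<And>d. d \<in> D \<Longrightarrow> \<not> leaf d"
proof -
  let ?m = "\<lambda>D. card {d \<in> D. leaf d}"
  obtain D where D: "D \<in> min_dominating_sets G"
    and least: "\<And>D'. D' \<in> min_dominating_sets G \<Longrightarrow> ?m D \<le> ?m D'"
    using min_dominating_sets_nonempty ex_has_least_nat[of "\<lambda>D. D \<in> min_dominating_sets G" _ ?m]
    by blast
  have "\<not> leaf l" if l: "l \<in> D" for l
  proof
    assume "leaf l"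
    then obtain s where s: "parcs G `` {l} = {s}" by (auto simp: is_singleton_def)
    have "(l, s) \<in> parcs G" using s by blast
    obtain q where "(l, q) \<in> parcs G" "q \<notin> D"
      using external_neighbour[OF D l \<open>(l, s) \<in> parcs G\<close>] .
    then have "s \<notin> D" using s by auto
    then have swapped: "insert s (D - {l}) \<in> min_dominating_sets G"
      using swap_min_dominating[OF D l, of s] s \<open>s \<notin> D\<close> by auto
    have "\<not> leaf s"
    proof
      assume "leaf s"
      then have "parcs G `` {s} = {l}"
        using arcs_symmetric[OF \<open>(l, s) \<in> parcs G\<close>] by (rule leaf_neighbour)
      then show False using corona_if_adjacent_leaves s assms(2) by blast
    qed
    then have "{d \<in> insert s (D - {l}). leaf d} = {d \<in> D. leaf d} - {l}" by auto
    moreover have "card ({d \<in> D. leaf d} - {l}) < ?m D"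
      using min_dominating_setD(2)[OF D] l \<open>leaf l\<close> by (intro card_Diff1_less) auto
    ultimately have "?m (insert s (D - {l})) < ?m D" by simp
    then show False using least[OF swapped] by simp
  qed
  then show ?thesis using that D by blast
qed

lemma min_dominating_set_unique_neighbour_leaf:
  assumes "2 \<le> card (pverts G)" "\<not> corona_graph G"
  obtains D where "D \<in> min_dominating_sets G"
    and "\<And>d q. d \<in> D \<Longrightarrow> parcs G `` {d} - D = {q} \<Longrightarrow> parcs G `` {q} = {d}"
proof -
  \<comment> \<open>Each edge inside \<open>D\<close> counts twice, once per arc, so minimising
    \<open>?m\<close> minimises the edges spanned.\<close>
  let ?m = "\<lambda>D. card (Restr (parcs G) D)"
  let ?P = "\<lambda>D. D \<in> min_dominating_sets G \<and> (\<forall>d\<in>D. \<not> leaf d)"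
  obtain D where "?P D" and least: "\<And>D'. ?P D' \<Longrightarrow> ?m D \<le> ?m D'"
    using leafless_min_dominating_set[OF assms] ex_has_least_nat[of ?P _ ?m] by metis
  then have D: "D \<in> min_dominating_sets G" and leafless: "\<And>d. d \<in> D \<Longrightarrow> \<not> leaf d" by auto
  have "parcs G `` {q} = {d}" if d: "d \<in> D" and q: "parcs G `` {d} - D = {q}" for d q
  proof (rule ccontr)
    assume neq: "parcs G `` {q} \<noteq> {d}"
    have qd: "(q, d) \<in> parcs G" "(d, q) \<in> parcs G" "q \<notin> D" using q arcs_symmetric by blast+
    have "parcs G `` {d} \<noteq> {q}" using leafless[OF d] by (auto simp: is_singleton_def)
    then obtain w where w: "(d, w) \<in> parcs G" "w \<in> D" using q by blast
    have priv: "e = d" if "(q, e) \<in> parcs G" "e \<in> D" for e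
      using unique_external_neighbour_private[OF D d w q that] .
    let ?D = "insert q (D - {d})"
    have "?D \<in> min_dominating_sets G" using swap_min_dominating[OF D d q] .
    moreover have "\<not> leaf q" using neq qd(1) leaf_neighbour by blast
    ultimately have "?P ?D" using leafless by blast
    \<comment> \<open>No edge is gained, since \<open>d\<close> is the only neighbour of
      \<open>q\<close> in \<open>D\<close>; the edge from \<open>d\<close> to \<open>w\<close> is
      lost with \<open>d\<close>.\<close>
    have "Restr (parcs G) ?D \<subseteq> Restr (parcs G) D - {(d, w)}"
      using priv arcs_symmetric no_loops' by blast
    then have "Restr (parcs G) ?D \<subset> Restr (parcs G) D" using d w by blast
    then have "?m ?D < ?m D" using pair_finite_arcs by (intro psubset_card_mono) auto
    then show False using least[OF \<open>?P ?D\<close>] by simp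
  qed
  then show ?thesis using that D by blast
qed

section \<open>Counting components of the tree minus \<open>D\<close>\<close>

text \<open>A path from \<open>r\<close> meets one of \<open>d\<close>, \<open>d'\<close> first.\<close>

lemma separated:
  assumes "r \<in> pverts G" "d \<in> pverts G" "r \<noteq> d" "r \<noteq> d'" "d \<noteq> d'"
  shows "(r, d) \<in> away {d'} \<or> (r, d') \<in> away {d}"
proof -
  \<comment> \<open>Invariant along the walk: both vertices have been avoided so far, or one was
    reached while avoiding the other. At \<open>z = d\<close> the first alternative is
    impossible.\<close>
  have "(r, z) \<in> away {d, d'} \<or> (r, d) \<in> away {d'} \<or> (r, d') \<in> away {d}"
    if "(r, z) \<in> away {}" for z
    using that
  proof (induct rule: rtrancl_on_induct)
    case base
    then show ?case using assms by auto
  next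
    case (step y z)
    show ?case
    proof (cases "(r, y) \<in> away {d, d'}")
      case True
      then have "(r, y) \<in> away {d}" "(r, y) \<in> away {d'}" by (auto elim: away_mono)
      then show ?thesis
        using True step(2,4) assms(5)
        by (cases "z = d \<or> z = d'") (auto intro: rtrancl_on_into_rtrancl_on)
    qed (use step in blast)
  qed
  from this[OF connected_away[OF assms(1,2)]] show ?thesis
    using in_rtrancl_on_in_F by fast
qed

text \<open>If \<open>c d1\<close> and \<open>c d2\<close> were joined outside \<open>D\<close>, a
  path from \<open>r\<close> reaching \<open>d2\<close> without \<open>d1\<close> would continue
  through \<open>c d2\<close> to \<open>c d1\<close>, although \<open>d1\<close> separates
  \<open>c d1\<close> from \<open>r\<close>. By \<open>separated\<close> such a path exists for one
  order of the two vertices.\<close>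

lemma card_less_num_components:
  assumes D: "D \<subseteq> pverts G" and r: "r \<in> pverts G - D"
    and c: "\<And>d. d \<in> D \<Longrightarrow> (d, c d) \<in> parcs G \<and> c d \<notin> D \<and> (c d, r) \<notin> away {d}"
  shows "card D < num_components (delete_verts (with_proj G) D)"
proof -
  let ?C = "\<lambda>u. away D `` {u}"
  have self: "u \<in> ?C u" if "u \<in> pverts G - D" for u using that by simp
  have cV: "c d \<in> pverts G - D" if "d \<in> D" for d using c[OF that] in_arcsD2 by blast
  have "inj_on (?C \<circ> c) D"
  proof (rule inj_onI, rule ccontr)
    fix d d' assume d: "d \<in> D" "d' \<in> D" "(?C \<circ> c) d = (?C \<circ> c) d'" and "d \<noteq> d'"
    have "(c d, c d') \<in> away D" using self[OF cV[OF d(2)]] d(3) by auto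
    have *: "(r, d2) \<notin> away {d1}"
      if "d1 \<in> D" "d2 \<in> D" "d1 \<noteq> d2" "(c d1, c d2) \<in> away D" for d1 d2
    proof
      assume "(r, d2) \<in> away {d1}"
      moreover have "(c d1, c d2) \<in> away {d1}" using that by (auto elim: away_mono)
      moreover have "(c d2, d2) \<in> away {d1}"
        using that c arcs_symmetric by (intro away_arc) auto
      ultimately have "(c d1, r) \<in> away {d1}" by (meson away_sym rtrancl_on_trans)
      then show False using c that by blast
    qed
    have "(r, d) \<in> away {d'} \<or> (r, d') \<in> away {d}"
      using d \<open>d \<noteq> d'\<close> r D by (intro separated) auto
    then show False
      using *[of d d'] *[of d' d] d \<open>d \<noteq> d'\<close> \<open>(c d, c d') \<in> away D\<close> away_sym by blast
  qed
  then have "card ((?C \<circ> c) ` D) = card D" by (rule card_image)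
  moreover have "?C r \<notin> (?C \<circ> c) ` D"
  proof
    assume "?C r \<in> (?C \<circ> c) ` D"
    then obtain d where d: "d \<in> D" "(c d, r) \<in> away D" using self[OF r] by auto
    then have "(c d, r) \<in> away {d}" by (auto elim: away_mono)
    then show False using c d by blast
  qed
  moreover have "insert (?C r) ((?C \<circ> c) ` D) \<subseteq> ?C ` (pverts G - D)"
    using cV r by auto
  moreover have "finite D" using D pair_finite_verts finite_subset by blast
  ultimately show ?thesis
    unfolding num_components_delete_verts
    using pair_finite_verts card_mono[of "?C ` (pverts G - D)"]
    by (metis (no_types, lifting) card_insert_disjoint finite_Diff finite_imageI less_eq_Suc_le)
qed

lemma not_corona_imp_components:
  assumes "2 \<le> card (pverts G)" "\<not> corona_graph G"
  shows "\<exists>D \<in> min_dominating_sets G. card D < num_components (delete_verts (with_proj G) D)"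
proof -
  obtain D where D: "D \<in> min_dominating_sets G"
    and unique: "\<And>d q. d \<in> D \<Longrightarrow> parcs G `` {d} - D = {q} \<Longrightarrow> parcs G `` {q} = {d}"
    using min_dominating_set_unique_neighbour_leaf[OF assms] by blast
  note DG = min_dominating_setD(1)[OF D]
  have ext: "\<exists>q. (d, q) \<in> parcs G \<and> q \<notin> D" if "d \<in> D" for d
    using has_neighbour[OF assms(1)] external_neighbour[OF D that] DG that by (metis subsetD)
  obtain r where r: "r \<in> pverts G - D" and good: "\<And>d. d \<in> D \<Longrightarrow> parcs G `` {d} - D \<noteq> {r}"
  proof (rule ccontr)
    assume "\<not> thesis"
    \<comment> \<open>Without a suitable root, each vertex outside \<open>D\<close> is the sole
      outside neighbour of some element of \<open>D\<close>, hence a leaf by \<open>unique\<close>.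
      These leaves turn out to match \<open>D\<close> bijectively, which gives a corona.\<close>
    with that have bad: "\<exists>d\<in>D. parcs G `` {d} - D = {r}" if "r \<in> pverts G - D" for r
      using that by blast
    have "\<exists>q. parcs G `` {d} - D = {q}" if d: "d \<in> D" for d
    proof -
      obtain q where q: "(d, q) \<in> parcs G" "q \<notin> D" using ext d by blast
      then obtain e where e: "e \<in> D" "parcs G `` {e} - D = {q}" using bad in_arcsD2 by blast
      then have "e = d" using unique[OF e] arcs_symmetric[OF q(1)] by auto
      then show ?thesis using e by blast
    qed
    then obtain \<pi> where \<pi>: "\<And>d. d \<in> D \<Longrightarrow> parcs G `` {d} - D = {\<pi> d}" by metis
    have leaf: "\<And>d. d \<in> D \<Longrightarrow> parcs G `` {\<pi> d} = {d}" using unique \<pi> by blast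
    have "bij_betw \<pi> D (pverts G - D)"
      unfolding bij_betw_def
    proof
      show "inj_on \<pi> D" using leaf by (metis inj_onI singleton_inject)
      show "\<pi> ` D = pverts G - D"
      proof
        show "\<pi> ` D \<subseteq> pverts G - D" using \<pi> in_arcsD2 by blast
        show "pverts G - D \<subseteq> \<pi> ` D" using bad \<pi> by blast
      qed
    qed
    moreover have "D \<noteq> {}"
      using min_dominating_setD(4)[OF D] assms(1) by fastforce
    ultimately show False using corona_graphI[OF DG] leaf assms(2) by blast
  qed
  \<comment> \<open>A sole outside neighbour is a leaf other than \<open>r\<close>, isolated once
    \<open>d\<close> is deleted. Of two outside neighbours, at most one reaches \<open>r\<close>
    without \<open>d\<close>, as otherwise a cycle through \<open>d\<close> arises.\<close>
  have "\<exists>x. (d, x) \<in> parcs G \<and> x \<notin> D \<and> (x, r) \<notin> away {d}" if d: "d \<in> D" for d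
  proof -
    obtain q where q: "(d, q) \<in> parcs G" "q \<notin> D" using ext d by blast
    show ?thesis
    proof (cases "parcs G `` {d} - D = {q}")
      case True
      then have "q \<noteq> r" "parcs G `` {q} = {d}" using good unique d by blast+
      then have "(q, r) \<notin> away {d}"
        by (auto elim: converse_rtrancl_on_cases dest: in_rtrancl_on_in_F)
      then show ?thesis using q by blast
    next
      case False
      then obtain x where x: "(d, x) \<in> parcs G" "x \<notin> D" "x \<noteq> q" using q by blast
      have "(q, x) \<notin> away {d}" using cycle_through[OF q(1) x(1)] x(3) no_long_cycle by blast
      then have "(q, r) \<notin> away {d} \<or> (x, r) \<notin> away {d}"
        by (meson away_sym rtrancl_on_trans)
      then show ?thesis using q x by blast
    qed
  qed
  then obtain c where "\<And>d. d \<in> D \<Longrightarrow> (d, c d) \<in> parcs G \<and> c d \<notin> D \<and> (c d, r) \<notin> away {d}"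
    by metis
  then show ?thesis using card_less_num_components[OF DG r] D by blast
qed

end

theorem theorem1:
  fixes T :: "'a pair_pre_digraph"
  assumes "undirected_tree T" and "2 \<le> card (pverts T)"
  shows "(\<not> corona_graph T \<longleftrightarrow>
           (\<exists>D \<in> min_dominating_sets T. card D < num_components (delete_verts (with_proj T) D))) \<and>
         (\<not> corona_graph T \<longleftrightarrow> accurate_domination_number T = domination_number T) \<and>
         (\<not> corona_graph T \<longleftrightarrow>
           (\<exists>D \<in> min_dominating_sets T. \<forall>D' \<in> min_dominating_sets T. D \<inter> D' \<noteq> {}))"
    (is "(?one \<longleftrightarrow> ?two) \<and> (?one \<longleftrightarrow> ?three) \<and> (?one \<longleftrightarrow> ?four)")
proof -
  interpret pair_tree T
    using assms(1) by (simp add: undirected_tree_def pair_tree_def pair_tree_axioms_def)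
  \<comment> \<open>The implications run from (1) to (2) to (4) and back to (1); (3) is linked to
    (4) alone.\<close>
  have "?one \<Longrightarrow> ?two" using not_corona_imp_components[OF assms(2)] .
  moreover have "?four" if ?two
  proof -
    from that obtain D where D: "D \<in> min_dominating_sets T"
      "card D < num_components (delete_verts (with_proj T) D)" by blast
    have "D \<inter> D' \<noteq> {}" if D': "D' \<in> min_dominating_sets T" for D'
    proof
      assume "D \<inter> D' = {}"
      then have "D' \<subseteq> pverts T - D" using min_dominating_setD(1)[OF D'] by blast
      then have "num_components (delete_verts (with_proj T) D) \<le> card D'"
        using D' by (intro num_components_le_card_dominating) (auto simp: min_dominating_sets_def)
      then show False
        using D(2) min_dominating_setD(3)[OF D(1)] min_dominating_setD(3)[OF D'] by simp
    qed
    then show ?thesis using D(1) by blast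
  qed
  moreover have "?four \<Longrightarrow> ?one"
  proof
    assume ?four and "corona_graph T"
    then obtain D where D: "D \<in> min_dominating_sets T"
      "\<forall>D' \<in> min_dominating_sets T. D \<inter> D' \<noteq> {}" by blast
    have "card (pverts T - D) \<le> card D"
      using corona_card_complement_le[OF \<open>corona_graph T\<close>, of D] D(1)
      by (simp add: min_dominating_sets_def)
    then have "pverts T - D \<in> min_dominating_sets T"
      using has_neighbour[OF assms(2)] by (intro complement_min_dominating[OF D(1)]) blast+
    then show False using D(2) by blast
  qed
  moreover have "?three \<longleftrightarrow> ?four"
    using assms(2) by (intro accurate_domination_number_eq_iff) auto
  ultimately show ?thesis by blast
qed

end
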